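(* For $a\in\mathbb{R}$ let $(R_n)_{n\geq 1}$ be the sequence of polynomials (depending on $a$) defined by $R_1(x)=x$ and, for $n\geq 1$, $R_{n+1}(x)=xR_n(x)-\frac{a}{n}(1-x^2)R_n'(x)$. For $n\geq 1$, let $$T_n(x)=\lim_{a\to\pm\infty}\frac{R_n(x)}{a^{n-1}}.$$ For $n\geq 0$, let $V_n$ be the polynomial such that $\tanh^{(n)}(x)=V_n(\tanh x)$, where $\tanh^{(n)}$ denotes the $n$th derivative of $\tanh$. Then for all $n\geq 1$, $$T_n(x)=(-1)^{n-1}\frac{V_{n-1}(x)}{(n-1)!}.$$
   Context: The limit defining $T_n$ exists (and is the same as $a\to+\infty$ and as $a\to-\infty$) because, viewed as a polynomial in $a$, $R_n$ has degree $n-1$; $T_n(x)$ is the coefficient of $a^{n-1}$ in $R_n(x)$. *)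

theory Defs
  imports "HOL-Analysis.Analysis" "HOL-Computational_Algebra.Polynomial"
begin

(* The sequence starts at index 1; the value at index 0 is a dummy. *)
fun R :: "real \<Rightarrow> nat \<Rightarrow> real poly" where
  "R a 0 = 0"
| "R a (Suc 0) = [:0, 1:]"
| "R a (Suc (Suc n)) =
     [:0, 1:] * R a (Suc n)
       - smult (a / real (Suc n)) ([:1, 0, -1:] * pderiv (R a (Suc n)))"

definition T :: "nat \<Rightarrow> real \<Rightarrow> real" where
  "T n x = (THE l.
     ((\<lambda>a. poly (R a n) x / a ^ (n - 1)) \<longlongrightarrow> l) at_top \<and>
     ((\<lambda>a. poly (R a n) x / a ^ (n - 1)) \<longlongrightarrow> l) at_bot)"

definition V :: "nat \<Rightarrow> real poly" where
  "V n = (THE p. \<forall>x::real. (deriv ^^ n) tanh x = poly p (tanh x))"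

lemma V_exists: "\<exists>p. \<forall>x::real. (deriv ^^ n) tanh x = poly p (tanh x)"
proof (induction n)
  case 0
  show ?case by (rule exI[of _ "[:0, 1:]"]) simp
next
  case (Suc n)
  then obtain p where p: "\<And>x::real. (deriv ^^ n) tanh x = poly p (tanh x)" by blast
  have "(deriv ^^ Suc n) tanh x = poly ([:1, 0, -1:] * pderiv p) (tanh x)" for x :: real
  proof -
    have "cosh x \<noteq> 0"
      using cosh_real_pos[of x] by linarith
    then have "(tanh has_field_derivative 1 - (tanh x)\<^sup>2) (at x)"
      by (auto intro!: derivative_eq_intros)
    from DERIV_chain2[OF poly_DERIV this, of p]
    have "((\<lambda>x. poly p (tanh x)) has_field_derivative
        poly ([:1, 0, -1:] * pderiv p) (tanh x)) (at x)"
      by (simp add: power2_eq_square algebra_simps)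
    moreover have "(deriv ^^ n) tanh = (\<lambda>x::real. poly p (tanh x))"
      using p by (rule ext)
    ultimately show ?thesis
      by (simp add: DERIV_imp_deriv)
  qed
  then show ?case by blast
qed

lemma V_unique:
  fixes p q :: "real poly"
  assumes "\<And>x::real. poly p (tanh x) = poly q (tanh x)"
  shows "p = q"
proof (rule ccontr)
  assume "p \<noteq> q"
  then have "finite {y. poly (p - q) y = 0}"
    by (intro poly_roots_finite) simp
  moreover have "range (tanh :: real \<Rightarrow> real) \<subseteq> {y. poly (p - q) y = 0}"
    using assms by auto
  ultimately have "finite (range (tanh :: real \<Rightarrow> real))"
    using finite_subset by blast
  moreover have "inj (tanh :: real \<Rightarrow> real)"
    by (simp add: inj_on_def)
  ultimately show False
    using finite_imageD infinite_UNIV_char_0 by blast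
qed

lemma V_characterization: "(deriv ^^ n) tanh x = poly (V n) (tanh x)" for x :: real
proof -
  have "\<exists>!p. \<forall>x::real. (deriv ^^ n) tanh x = poly p (tanh x)"
  proof (rule ex_ex1I)
    show "\<exists>p. \<forall>x::real. (deriv ^^ n) tanh x = poly p (tanh x)"
      by (rule V_exists)
  next
    fix p q
    assume "\<forall>x::real. (deriv ^^ n) tanh x = poly p (tanh x)"
      and "\<forall>x::real. (deriv ^^ n) tanh x = poly q (tanh x)"
    then show "p = q"
      by (intro V_unique) simp
  qed
  from theI'[OF this] show ?thesis
    unfolding V_def by (rule spec)
qed

end

theory Submission
  imports Defs
begin

text \<open>
  Dividing by \<open>a ^ n\<close>, the recursion for \<open>R\<close> becomes one for \<open>R a (n + 1) / a ^ n\<close>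
  in which the term \<open>x R\<close> carries a factor \<open>1 / a\<close>. In the limit only the term
  \<open>-(1 - x\<^sup>2) R' / n\<close> survives, and up to the factor \<open>-1 / n\<close> this is the recursion
  \<open>V (n + 1) = (1 - x\<^sup>2) V' n\<close> given by the chain rule for \<open>tanh' = 1 - tanh\<^sup>2\<close>.
  Coefficientwise convergence, unlike pointwise convergence, passes to derivatives, and with a
  uniform degree bound it implies pointwise convergence.
\<close>

lemma V_0: "V 0 = [:0, 1:]"
  by (rule V_unique) (simp flip: V_characterization)

text \<open>By \<open>V_unique\<close> it suffices to compare values at \<open>tanh x\<close>, where
  the chain rule applies.\<close>

lemma V_Suc: "V (Suc n) = [:1, 0, -1:] * pderiv (V n)"
proof (rule V_unique)
  fix x :: real
  have "cosh x \<noteq> 0"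
    using cosh_real_pos[of x] by linarith
  then have "(tanh has_field_derivative 1 - (tanh x)\<^sup>2) (at x)"
    by (auto intro!: derivative_eq_intros)
  from DERIV_chain2[OF poly_DERIV this, of "V n"]
  have "((\<lambda>x. poly (V n) (tanh x)) has_field_derivative
      poly ([:1, 0, -1:] * pderiv (V n)) (tanh x)) (at x)"
    by (simp add: power2_eq_square algebra_simps)
  moreover have "(deriv ^^ n) tanh = (\<lambda>x::real. poly (V n) (tanh x))"
    using V_characterization by (rule ext)
  ultimately have "(deriv ^^ Suc n) tanh x = poly ([:1, 0, -1:] * pderiv (V n)) (tanh x)"
    by (simp add: DERIV_imp_deriv)
  then show "poly (V (Suc n)) (tanh x) = poly ([:1, 0, -1:] * pderiv (V n)) (tanh x)"
    unfolding V_characterization .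
qed

text \<open>The degree lost in \<open>pderiv\<close> offsets one of the two gained from 1 - x^2. The
  bound does not depend on \<open>a\<close>.\<close>

lemma degree_R_le: "degree (R a n) \<le> n"
proof (induction a n rule: R.induct)
  case (3 a n)
  have "degree ([:0, 1:] * R a (Suc n)) \<le> Suc (Suc n)"
    using 3 by (intro order.trans[OF degree_mult_le]) simp
  moreover have "degree ([:1, 0, -1:] * pderiv (R a (Suc n))) \<le> Suc (Suc n)"
    using 3 by (intro order.trans[OF degree_mult_le]) (simp add: degree_pderiv)
  ultimately show ?case
    unfolding R.simps by (intro degree_diff_le order.trans[OF degree_smult_le])
qed simp_all

text \<open>A coefficient of a product is a Cauchy sum whose length depends only on
  \<open>k\<close>, so limits pass through it.\<close>

lemma tendsto_coeff_mult_left: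
  fixes p :: "'a \<Rightarrow> real poly"
  assumes "\<And>k. ((\<lambda>a. coeff (p a) k / c a) \<longlongrightarrow> coeff q k) F"
  shows "((\<lambda>a. coeff (r * p a) k / c a) \<longlongrightarrow> coeff (r * q) k) F"
proof -
  have "((\<lambda>a. \<Sum>i\<le>k. coeff r i * (coeff (p a) (k - i) / c a)) \<longlongrightarrow>
      (\<Sum>i\<le>k. coeff r i * coeff q (k - i))) F"
    by (intro tendsto_intros assms)
  then show ?thesis
    by (simp add: coeff_mult sum_divide_distrib)
qed

lemma tendsto_coeff_pderiv:
  fixes p :: "'a \<Rightarrow> real poly"
  assumes "\<And>k. ((\<lambda>a. coeff (p a) k / c a) \<longlongrightarrow> coeff q k) F"
  shows "((\<lambda>a. coeff (pderiv (p a)) k / c a) \<longlongrightarrow> coeff (pderiv q) k) F"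
  using tendsto_mult_left[OF assms[of "Suc k"], of "real (Suc k)"]
  by (simp add: coeff_pderiv)

lemma tendsto_coeff_R:
  "((\<lambda>a. coeff (R a (Suc n)) k / a ^ n) \<longlongrightarrow>
    coeff (smult ((-1) ^ n / fact n) (V n)) k) at_infinity"
proof (induction n arbitrary: k)
  case 0
  show ?case by (simp add: V_0)
next
  case (Suc n)
  let ?W = "smult ((-1) ^ n / fact n) (V n)"
  have A: "((\<lambda>a. coeff ([:0, 1:] * R a (Suc n)) k / a ^ n) \<longlongrightarrow> coeff ([:0, 1:] * ?W) k) at_infinity"
    by (intro tendsto_coeff_mult_left Suc)
  have B: "((\<lambda>a. coeff ([:1, 0, -1:] * pderiv (R a (Suc n))) k / a ^ n) \<longlongrightarrow>
      coeff ([:1, 0, -1:] * pderiv ?W) k) at_infinity"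
    by (intro tendsto_coeff_mult_left tendsto_coeff_pderiv Suc)
  \<comment> \<open>Of the extra factor 1/a, the first term keeps all and vanishes in the limit; in
    the second it cancels the \<open>a\<close> of the recursion.\<close>
  have lim: "((\<lambda>a. inverse a * (coeff ([:0, 1:] * R a (Suc n)) k / a ^ n) -
      1 / real (Suc n) * (coeff ([:1, 0, -1:] * pderiv (R a (Suc n))) k / a ^ n)) \<longlongrightarrow>
      0 * coeff ([:0, 1:] * ?W) k - 1 / real (Suc n) * coeff ([:1, 0, -1:] * pderiv ?W) k) at_infinity"
    by (intro tendsto_diff tendsto_mult tendsto_const tendsto_inverse_0 A B)
  have lim_eq: "0 * coeff ([:0, 1:] * ?W) k - 1 / real (Suc n) * coeff ([:1, 0, -1:] * pderiv ?W) k
      = coeff (smult ((-1) ^ Suc n / fact (Suc n)) (V (Suc n))) k"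
    unfolding V_Suc pderiv_smult mult_smult_right coeff_smult fact_Suc by simp
  \<comment> \<open>The cancellation requires \<open>a\<close> to be nonzero, which holds
    eventually.\<close>
  have ev: "\<forall>\<^sub>F a in at_infinity.
      inverse a * (coeff ([:0, 1:] * R a (Suc n)) k / a ^ n) -
        1 / real (Suc n) * (coeff ([:1, 0, -1:] * pderiv (R a (Suc n))) k / a ^ n) =
      coeff (R a (Suc (Suc n))) k / a ^ Suc n"
    using eventually_not_equal_at_infinity[of 0]
  proof eventually_elim
    case (elim a)
    then have "inverse a * (p / a ^ n) - 1 / m * (q / a ^ n) = (p - a / m * q) / a ^ Suc n" for p q m
      by (simp add: divide_simps)
    then show ?case
      unfolding R.simps coeff_diff coeff_smult .
  qed
  show ?case
    using Lim_transform_eventually[OF lim ev] unfolding lim_eq .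
qed

lemma tendsto_poly_R:
  "((\<lambda>a. poly (R a (Suc n)) x / a ^ n) \<longlongrightarrow>
    (-1) ^ n * poly (V n) x / fact n) at_infinity"
proof -
  define W where "W = smult ((-1) ^ n / fact n) (V n)"
  \<comment> \<open>A common bound for the degrees of \<open>W\<close> and of all
    \<open>R a (Suc n)\<close>, so that both expand over the same fixed index set.\<close>
  define N where "N = max (Suc n) (degree W)"
  have poly_sum: "poly p x = (\<Sum>k\<le>N. coeff p k * x ^ k)" if "degree p \<le> N" for p
    unfolding poly_altdef using that
    by (intro sum.mono_neutral_left) (auto simp: coeff_eq_0)
  have "((\<lambda>a. \<Sum>k\<le>N. coeff (R a (Suc n)) k / a ^ n * x ^ k) \<longlongrightarrow>
      (\<Sum>k\<le>N. coeff W k * x ^ k)) at_infinity"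
    unfolding W_def by (intro tendsto_sum tendsto_mult tendsto_const tendsto_coeff_R)
  moreover have "poly (R a (Suc n)) x = (\<Sum>k\<le>N. coeff (R a (Suc n)) k * x ^ k)" for a
    using degree_R_le[of a "Suc n"] by (intro poly_sum) (simp add: N_def)
  moreover have "poly W x = (\<Sum>k\<le>N. coeff W k * x ^ k)"
    by (intro poly_sum) (simp add: N_def)
  ultimately have "((\<lambda>a. poly (R a (Suc n)) x / a ^ n) \<longlongrightarrow> poly W x) at_infinity"
    by (simp add: sum_divide_distrib)
  then show ?thesis
    by (simp add: W_def)
qed

theorem proposition10:
  fixes n :: nat and x :: real
  assumes "n \<ge> 1"
  shows "((\<lambda>a. poly (R a n) x / a ^ (n - 1)) \<longlongrightarrow> T n x) at_top \<and>
         ((\<lambda>a. poly (R a n) x / a ^ (n - 1)) \<longlongrightarrow> T n x) at_bot \<and>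
         T n x = (-1) ^ (n - 1) * poly (V (n - 1)) x / fact (n - 1)"
proof -
  let ?f = "\<lambda>a. poly (R a n) x / a ^ (n - 1)"
  let ?L = "(-1) ^ (n - 1) * poly (V (n - 1)) x / fact (n - 1)"
  have "(?f \<longlongrightarrow> ?L) at_infinity"
    using tendsto_poly_R[of "n - 1" x] assms by simp
  \<comment> \<open>On the reals, \<open>at_infinity\<close> means that \<bar>a\<bar> grows, so one
    limit there yields both one-sided limits with the same value.\<close>
  then have top: "(?f \<longlongrightarrow> ?L) at_top" and bot: "(?f \<longlongrightarrow> ?L) at_bot"
    by (rule tendsto_mono[OF at_top_le_at_infinity], rule tendsto_mono[OF at_bot_le_at_infinity])
  have "T n x = ?L"
    unfolding T_def
  proof (rule the_equality)
    show "(?f \<longlongrightarrow> ?L) at_top \<and> (?f \<longlongrightarrow> ?L) at_bot"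
      using top bot ..
    show "l = ?L" if "(?f \<longlongrightarrow> l) at_top \<and> (?f \<longlongrightarrow> l) at_bot" for l
      using tendsto_unique[OF trivial_limit_at_top_linorder conjunct1[OF that] top] .
  qed
  then show ?thesis
    using top bot by simp
qed

end
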